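(* Suppose the polyhedron $P$ is in general position, with bounding half-spaces $H_1,\dots,H_n$. For each $J\in\mathcal F$, the equation $$ \prod_{j\in [n]\setminus J} H\left(\sum_{i=1}^d \tilde a_{ij}x_i+ \tilde b_j\right) =\sum_{F\in\mathcal F_J}\ \prod_{j\in F\setminus J} \left(H\left(\sum_{i=1}^d \tilde a_{ij}x_i+ \tilde b_j\right)-1\right) $$ holds for any $x\in V(J,\tilde a,\tilde b)$.
   Context: Let $d,n\ge 1$, $[n]=\{1,\dots,n\}$, and let $\tilde a=(\tilde a_{ij})\in\mathbf R^{d\times n}$, $\tilde b=(\tilde b_1,\dots,\tilde b_n)^\top\in\mathbf R^n$. Set $H_j=\{x\in\mathbf R^d:\sum_{i=1}^d\tilde a_{ij}x_i+\tilde b_j\ge 0\}$ for $1\le j\le n$ and $P=\bigcap_{j=1}^nH_j$. Bounding half-spaces: $H_1,\dots,H_n$ are the bounding half-spaces of $P$ if $P$ has nonempty interior, every column of $\tilde a$ is nonzero, and the sets $F_j=P\cap\{x:\sum_{i}\tilde a_{ij}x_i+\tilde b_j=0\}$, $1\le j\le n$, are pairwise distinct and are exactly the facets of $P$. General position: put $\hat f_0(x_0,x)=x_0$ and $\hat f_j(x_0,x)=\sum_{i=1}^d\tilde a_{ij}x_i+\tilde b_jx_0$ $(1\le j\le n)$ for $(x_0,x)\in\mathbf R\times\mathbf R^d$, and let $\hat P=\{(x_0,x):\hat f_j(x_0,x)\ge0,\ 0\le j\le n\}$. With $H_1,\dots,H_n$ the bounding half-spaces of $P$, the polyhedron $P$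 is in general position if for every $J\subset\{0,1,\dots,n\}$ such that some nonzero point of $\hat P$ satisfies $\hat f_j=0$ for all $j\in J$, the linear forms $\hat f_j$ $(j\in J)$ are linearly independent. $\mathcal F=\{J\subset[n]:\bigcap_{j\in J}F_j\neq\emptyset\}$ (with $\emptyset\in\mathcal F$) is the abstract simplicial complex associated with $P$, and for $J\in\mathcal F$, $\mathcal F_J=\{F\in\mathcal F: J\subset F\}$. $H:\mathbf R\to\mathbf R$ is the Heaviside function, $H(x)=1$ for $x\ge0$ and $H(x)=0$ for $x<0$. $V(J,\tilde a,\tilde b)=\{x\in\mathbf R^d:\sum_{i=1}^d\tilde a_{ij}x_i+\tilde b_j=0\ (j\in J)\}$. Empty products equal $1$. *)

theory Defs
  imports "HOL-Analysis.Analysis"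
begin

text \<open>The index set \<open>[n]\<close> is the universe of a finite type \<open>'n\<close>, and Euclidean \<open>d\<close>-space
  is \<open>real ^ 'd\<close> for a finite type \<open>'d\<close>; both types are nonempty, so \<open>n \<ge> 1\<close> and \<open>d \<ge> 1\<close>.
  The entry with row \<open>i\<close> and column \<open>j\<close> of the coefficient matrix is \<open>a $ i $ j\<close>.\<close>

definition aff_form :: "real ^ 'n ^ 'd \<Rightarrow> real ^ 'n \<Rightarrow> 'n \<Rightarrow> real ^ 'd \<Rightarrow> real" where
  "aff_form a b j x = (\<Sum>i\<in>UNIV. a $ i $ j * x $ i) + b $ j"

definition halfspace :: "real ^ 'n ^ 'd \<Rightarrow> real ^ 'n \<Rightarrow> 'n \<Rightarrow> (real ^ 'd) set" where
  "halfspace a b j = {x. aff_form a b j x \<ge> 0}"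

definition polyhedron_of :: "real ^ 'n ^ 'd \<Rightarrow> real ^ 'n \<Rightarrow> (real ^ 'd) set" where
  "polyhedron_of a b = (\<Inter>j. halfspace a b j)"

definition facet :: "real ^ 'n ^ 'd \<Rightarrow> real ^ 'n \<Rightarrow> 'n \<Rightarrow> (real ^ 'd) set" where
  "facet a b j = polyhedron_of a b \<inter> {x. aff_form a b j x = 0}"

definition bounding_halfspaces :: "real ^ 'n ^ 'd \<Rightarrow> real ^ 'n \<Rightarrow> bool" where
  "bounding_halfspaces a b \<longleftrightarrow>
     interior (polyhedron_of a b) \<noteq> {} \<and>
     (\<forall>j. column j a \<noteq> 0) \<and>
     inj (facet a b) \<and>
     range (facet a b) = {G. G facet_of polyhedron_of a b}"

text \<open>The homogenised linear forms on \<open>real \<times> (real ^ 'd)\<close>, indexed by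
  \<open>{0,1,...,n}\<close>, which is encoded as \<open>'n option\<close> with \<open>None\<close> playing the role of \<open>0\<close>.\<close>

fun hom_form :: "real ^ 'n ^ 'd \<Rightarrow> real ^ 'n \<Rightarrow> 'n option \<Rightarrow> real \<times> (real ^ 'd) \<Rightarrow> real" where
  "hom_form a b None (x0, x) = x0"
| "hom_form a b (Some j) (x0, x) = (\<Sum>i\<in>UNIV. a $ i $ j * x $ i) + b $ j * x0"

definition hom_cone :: "real ^ 'n ^ 'd \<Rightarrow> real ^ 'n \<Rightarrow> (real \<times> (real ^ 'd)) set" where
  "hom_cone a b = {z. \<forall>j. hom_form a b j z \<ge> 0}"

text \<open>Linear independence of the family \<open>(f j)\<close>, \<open>j \<in> J\<close> (for finite \<open>J\<close>), so a repeated form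
  makes the family dependent. Function types carry no vector space instance, hence
  the library's \<open>independent\<close> does not apply.\<close>

definition independent_family :: "('i \<Rightarrow> 'v \<Rightarrow> real) \<Rightarrow> 'i set \<Rightarrow> bool" where
  "independent_family f J \<longleftrightarrow>
     (\<forall>c. (\<forall>z. (\<Sum>j\<in>J. c j * f j z) = 0) \<longrightarrow> (\<forall>j\<in>J. c j = 0))"

definition general_position :: "real ^ 'n ^ 'd \<Rightarrow> real ^ 'n \<Rightarrow> bool" where
  "general_position a b \<longleftrightarrow>
     (\<forall>J. (\<exists>z\<in>hom_cone a b. z \<noteq> 0 \<and> (\<forall>j\<in>J. hom_form a b j z = 0)) \<longrightarrow>
          independent_family (hom_form a b) J)"

text \<open>For \<open>J = {}\<close> the intersection is \<open>UNIV\<close>, so the empty set always belongs to the complex.\<close>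

definition face_complex :: "real ^ 'n ^ 'd \<Rightarrow> real ^ 'n \<Rightarrow> 'n set set" where
  "face_complex a b = {J. (\<Inter>j\<in>J. facet a b j) \<noteq> {}}"

definition face_complex_above :: "real ^ 'n ^ 'd \<Rightarrow> real ^ 'n \<Rightarrow> 'n set \<Rightarrow> 'n set set" where
  "face_complex_above a b J = {F \<in> face_complex a b. J \<subseteq> F}"

definition heaviside :: "real \<Rightarrow> real" where
  "heaviside t = (if t \<ge> 0 then 1 else 0)"

definition flat :: "'n set \<Rightarrow> real ^ 'n ^ 'd \<Rightarrow> real ^ 'n \<Rightarrow> (real ^ 'd) set" where
  "flat J a b = {x. \<forall>j\<in>J. aff_form a b j x = 0}"

end

theory Submission
  imports Defs
begin

text \<open>If \<open>x\<close> lies on all hyperplanes indexed by \<open>J\<close>, let \<open>N\<close> be the set of indices of the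
  half-spaces that miss \<open>x\<close>. The left-hand side is \<open>1\<close> if \<open>N\<close> is empty and \<open>0\<close> otherwise, and the
  right-hand side is the alternating sum over the \<open>G \<subseteq> N\<close> for which the face \<open>K\<^sub>G\<close> of
  \<open>P \<inter> V(J)\<close> cut out by \<open>G\<close> is nonempty. Project these faces radially from \<open>x\<close>. A ray from \<open>x\<close>
  that meets \<open>P \<inter> V(J)\<close> enters it at a point lying on the hyperplanes of some nonempty
  \<open>N\<^sub>0 \<subseteq> N\<close>, and it meets \<open>K\<^sub>G\<close> iff \<open>G \<subseteq> N\<^sub>0\<close>; so the alternating sum of
  the indicators of the projected faces vanishes identically. As the Euler characteristic is a
  valuation, the alternating number of nonempty faces vanishes too.\<close>

section \<open>The Euler characteristic as a valuation on compact convex sets\<close>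

text \<open>Compare the vanishing sum at \<open>t\<close> with the one just to the right of
  \<open>t\<close>: they differ exactly by the coefficients of the intervals ending at
  \<open>t\<close>. So these coefficients cancel for each \<open>t\<close>, and every nonempty
  \<open>K i\<close> has exactly one right end.\<close>

lemma euler_valuation_real:
  fixes K :: "'i \<Rightarrow> real set" and c :: "'i \<Rightarrow> real"
  assumes fin: "finite I"
    and K: "\<And>i. i \<in> I \<Longrightarrow> compact (K i) \<and> convex (K i)"
    and sum0: "\<And>t. (\<Sum>i\<in>I. c i * of_bool (t \<in> K i)) = 0"
  shows "(\<Sum>i\<in>I. c i * of_bool (K i \<noteq> {})) = 0"
proof -
  define I' where "I' = {i\<in>I. K i \<noteq> {}}"
  have "\<exists>l u. K i = {l..u} \<and> l \<le> u" if "i \<in> I'" for i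
    using that K connected_compact_interval_1[of "K i"] convex_connected[of "K i"]
    by (fastforce simp: I'_def)
  then obtain l u where lu: "\<And>i. i \<in> I' \<Longrightarrow> K i = {l i..u i} \<and> l i \<le> u i"
    by metis
  have fin': "finite I'" using fin by (simp add: I'_def)
  have sum0': "(\<Sum>i\<in>I'. c i * of_bool (t \<in> K i)) = 0" for t
    using sum0[of t] fin by (subst (asm) sum.mono_neutral_right[of I I']) (auto simp: I'_def)
  have ends: "(\<Sum>i\<in>{i\<in>I'. u i = t}. c i) = 0" for t
  proof -
    have "\<forall>\<^sub>F s in at_right t. s \<in> K i \<longleftrightarrow> t \<in> K i \<and> u i \<noteq> t" if i: "i \<in> I'" for i
    proof -
      have "\<forall>\<^sub>F s in at_right t. t < s"
        by (simp add: eventually_at_right_less)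
      moreover have "\<forall>\<^sub>F s in at_right t. z \<le> t \<or> s < z" for z
        by (cases "z \<le> t") (auto simp: eventually_at_right_field intro: exI[of _ z])
      ultimately have "\<forall>\<^sub>F s in at_right t. t < s \<and> (l i \<le> t \<or> s < l i) \<and> (u i \<le> t \<or> s < u i)"
        by (simp add: eventually_conj)
      then show ?thesis
        by (rule eventually_mono) (use lu[OF i] in auto)
    qed
    then have "\<forall>\<^sub>F s in at_right t. \<forall>i\<in>I'. s \<in> K i \<longleftrightarrow> t \<in> K i \<and> u i \<noteq> t"
      using fin' by (simp add: eventually_ball_finite)
    then obtain s where s: "\<forall>i\<in>I'. s \<in> K i \<longleftrightarrow> t \<in> K i \<and> u i \<noteq> t"
      using eventually_happens trivial_limit_at_right_real by blast
    have "(\<Sum>i\<in>{i\<in>I'. u i = t}. c i) = (\<Sum>i\<in>I'. c i * of_bool (u i = t))"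
      using fin' by (simp add: sum.inter_filter of_bool_def if_distrib cong: if_cong)
    also have "\<dots> = (\<Sum>i\<in>I'. c i * of_bool (t \<in> K i) - c i * of_bool (s \<in> K i))"
      using s lu by (intro sum.cong) auto
    also have "\<dots> = 0"
      by (simp add: sum_subtractf sum0')
    finally show ?thesis .
  qed
  have "(\<Sum>i\<in>I. c i * of_bool (K i \<noteq> {})) = (\<Sum>i\<in>I'. c i)"
    using fin by (auto simp: I'_def of_bool_def sum.inter_filter if_distrib cong: if_cong)
  also have "\<dots> = (\<Sum>t\<in>u ` I'. \<Sum>i\<in>{i\<in>I'. u i = t}. c i)"
    using fin' by (rule sum.image_gen)
  finally show ?thesis by (simp add: ends)
qed

text \<open>A fibre of the projection along one more coordinate is a compact interval, so the
  one-dimensional case applies to each fibre.\<close>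

lemma euler_valuation:
  fixes K :: "'i \<Rightarrow> 'a::euclidean_space set" and c :: "'i \<Rightarrow> real"
  assumes fin: "finite I"
    and K: "\<And>i. i \<in> I \<Longrightarrow> compact (K i) \<and> convex (K i)"
    and sum0: "\<And>y. (\<Sum>i\<in>I. c i * of_bool (y \<in> K i)) = 0"
  shows "(\<Sum>i\<in>I. c i * of_bool (K i \<noteq> {})) = 0"
proof -
  \<comment> \<open>The slice of \<open>K i\<close> through \<open>y\<close> in the directions
    \<open>B\<close>: at most a point when \<open>B\<close> is empty, all of \<open>K i\<close> when
    \<open>B = Basis\<close>. The induction frees one coordinate at a time.\<close>
  define S where "S B i y = {k \<in> K i. \<forall>e\<in>Basis - B. k \<bullet> e = y \<bullet> e}" for B i and y :: 'a
  have "B \<subseteq> Basis \<Longrightarrow> (\<Sum>i\<in>I. c i * of_bool (S B i y \<noteq> {})) = 0"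
    if "finite B" for B :: "'a set" and y
    using that
  proof (induction B arbitrary: y rule: finite_induct)
    case empty
    have "S {} i y \<noteq> {} \<longleftrightarrow> y \<in> K i" for i
      by (auto simp: S_def euclidean_eq_iff[symmetric])
    then show ?case by (simp add: sum0)
  next
    case (insert e B)
    define T where "T i = (\<lambda>k. k \<bullet> e) ` S (insert e B) i y" for i
    have T: "compact (T i) \<and> convex (T i)" if "i \<in> I" for i
    proof -
      have S: "S (insert e B) i y = K i \<inter> (\<Inter>e'\<in>Basis - insert e B. {k. e' \<bullet> k = e' \<bullet> y})"
        by (auto simp: S_def inner_commute)
      have "compact (S (insert e B) i y)"
        unfolding S using K[OF that] by (intro compact_Int_closed closed_INT ballI closed_hyperplane) auto
      moreover have "convex (S (insert e B) i y)"
        unfolding S using K[OF that] by (intro convex_Int convex_INT convex_hyperplane) auto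
      ultimately show ?thesis unfolding T_def
        by (intro conjI compact_continuous_image continuous_intros convex_linear_image
            bounded_linear.linear bounded_linear_inner_left)
    qed
    \<comment> \<open>Setting coordinate \<open>e\<close> of \<open>y\<close> to \<open>t\<close>
      identifies the fibre over \<open>t\<close> with a slice in the directions \<open>B\<close>, so
      by the induction hypothesis the indicators of the \<open>T i\<close> cancel at
      \<open>t\<close>.\<close>
    have "t \<in> T i \<longleftrightarrow> S B i (y + (t - y \<bullet> e) *\<^sub>R e) \<noteq> {}" for t i
    proof -
      have "k \<bullet> e = t \<and> (\<forall>e'\<in>Basis - insert e B. k \<bullet> e' = y \<bullet> e') \<longleftrightarrow>
          (\<forall>e'\<in>Basis - B. k \<bullet> e' = (y + (t - y \<bullet> e) *\<^sub>R e) \<bullet> e')" for k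
        using insert.hyps insert.prems
        by (auto simp: inner_add_left inner_Basis split: if_splits)
      then have "(\<exists>k\<in>K i. k \<bullet> e = t \<and> (\<forall>e'\<in>Basis - insert e B. k \<bullet> e' = y \<bullet> e')) \<longleftrightarrow>
          S B i (y + (t - y \<bullet> e) *\<^sub>R e) \<noteq> {}"
        by (simp only: S_def) blast
      then show ?thesis
        unfolding T_def S_def by blast
    qed
    then have "(\<Sum>i\<in>I. c i * of_bool (t \<in> T i)) = 0" for t
      using insert.IH insert.prems by simp
    from euler_valuation_real[OF fin T this] show ?case
      by (simp add: T_def)
  qed
  from this[of Basis 0] show ?thesis by (simp add: S_def)
qed

section \<open>Faces visible from a point\<close>

lemma alternating_sum_Pow:
  assumes "finite N" "N \<noteq> {}"
  shows "(\<Sum>G\<in>Pow N. (-1) ^ card G) = (0::real)"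
  using assms prod_diff_conv_sum[of N "\<lambda>_. 1::real" "\<lambda>_. 1", symmetric] by (simp add: card_gt_0_iff)

text \<open>Central projection from the origin onto the hyperplane \<open>v \<bullet> y = 1\<close>
  carries segments in the half-space \<open>0 < v \<bullet> y\<close> to segments.\<close>

lemma convex_radial_projection:
  fixes v :: "'a::euclidean_space"
  assumes "convex K" and pos: "\<And>y. y \<in> K \<Longrightarrow> 0 < v \<bullet> y"
  shows "convex ((\<lambda>y. y /\<^sub>R (v \<bullet> y)) ` K)"
proof (rule convexI)
  fix p q and s t :: real
  assume "p \<in> (\<lambda>y. y /\<^sub>R (v \<bullet> y)) ` K" "q \<in> (\<lambda>y. y /\<^sub>R (v \<bullet> y)) ` K"
    and st: "0 \<le> s" "0 \<le> t" "s + t = 1"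
  then obtain y z where y: "y \<in> K" "p = y /\<^sub>R (v \<bullet> y)" and z: "z \<in> K" "q = z /\<^sub>R (v \<bullet> z)"
    by auto
  \<comment> \<open>\<open>s *\<^sub>R p + t *\<^sub>R q\<close> combines \<open>y\<close> and
    \<open>z\<close> with total weight \<open>r\<close>; dividing by \<open>r\<close> gives a point
    \<open>w\<close> of \<open>K\<close> on the same ray.\<close>
  define r where "r = s / (v \<bullet> y) + t / (v \<bullet> z)"
  define w where "w = (s / (v \<bullet> y) / r) *\<^sub>R y + (t / (v \<bullet> z) / r) *\<^sub>R z"
  have vpos: "0 < v \<bullet> y" "0 < v \<bullet> z" using y z pos by auto
  have r: "0 < r"
    using st vpos by (cases "s = 0") (auto simp: r_def add_pos_nonneg)
  have "s / (v \<bullet> y) / r + t / (v \<bullet> z) / r = 1"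
    using r by (simp only: add_divide_distrib[symmetric] r_def[symmetric]) simp
  then have "w \<in> K"
    unfolding w_def using st vpos r y z by (intro convexD[OF \<open>convex K\<close>]) auto
  have rw: "r *\<^sub>R w = s *\<^sub>R p + t *\<^sub>R q"
    using r y z by (simp add: w_def scaleR_right_distrib divide_inverse[symmetric])
  have "r * (v \<bullet> w) = v \<bullet> (r *\<^sub>R w)" by simp
  also have "\<dots> = 1"
    unfolding rw using st vpos by (simp add: inner_add_right y(2) z(2) mult.assoc)
  finally have "inverse (v \<bullet> w) = r"
    using r by (metis inverse_unique mult.commute)
  with rw \<open>w \<in> K\<close> show "s *\<^sub>R p + t *\<^sub>R q \<in> (\<lambda>y. y /\<^sub>R (v \<bullet> y)) ` K"
    by (intro image_eqI[of _ _ w]) auto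
qed

text \<open>The viewpoint is moved to the origin. The constraints it violates are indexed by
  \<open>N\<close> and scaled to right-hand side 1; \<open>C\<close> stands for the constraints it
  satisfies.\<close>

definition visible_face :: "'a::euclidean_space set \<Rightarrow> 'i set \<Rightarrow> ('i \<Rightarrow> 'a) \<Rightarrow> 'i set \<Rightarrow> 'a set" where
  "visible_face C N v G = {y \<in> C. (\<forall>j\<in>N. 1 \<le> v j \<bullet> y) \<and> (\<forall>j\<in>G. v j \<bullet> y = 1)}"

lemma visible_face_eq:
  "visible_face C N v G = C \<inter> ((\<Inter>j\<in>N. {y. 1 \<le> v j \<bullet> y}) \<inter> (\<Inter>j\<in>G. {y. v j \<bullet> y = 1}))"
  by (auto simp: visible_face_def)

text \<open>By compactness the ray through \<open>p\<close> has a first point \<open>y0\<close> in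
  the polyhedron. The projected faces containing \<open>p\<close> are those with
  \<open>G \<subseteq> N0\<close>, where \<open>N0\<close> collects the constraints in
  \<open>N\<close> tight at \<open>y0\<close>, and their signs cancel.\<close>

lemma alternating_sum_radial_projection:
  fixes C :: "'a::euclidean_space set" and v :: "'i \<Rightarrow> 'a"
  assumes C: "compact C" "convex C" "0 \<in> C"
    and N: "finite N" "m \<in> N"
  defines "q \<equiv> \<lambda>y. y /\<^sub>R (v m \<bullet> y)"
  shows "(\<Sum>G\<in>Pow N. (-1) ^ card G * of_bool (p \<in> q ` visible_face C N v G)) = (0::real)"
proof (cases "p \<in> q ` visible_face C N v {}")
  case False
  then have "p \<notin> q ` visible_face C N v G" for G
    by (auto simp: visible_face_def)
  then show ?thesis by simp
next
  case True
  define Q where "Q = visible_face C N v {}"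
  have Q: "0 < v m \<bullet> y" if "y \<in> Q" for y
    using that N(2) by (force simp: Q_def visible_face_def)
  \<comment> \<open>The condition \<open>q y = p\<close> with the denominator cleared, which
    exhibits \<open>Z\<close> as closed in \<open>Q\<close>.\<close>
  define Z where "Z = {y \<in> Q. v m \<bullet> p = 1 \<and> y = (v m \<bullet> y) *\<^sub>R p}"
  have Z: "Z = {y \<in> Q. q y = p}"
  proof -
    have "v m \<bullet> p = 1 \<and> y = (v m \<bullet> y) *\<^sub>R p \<longleftrightarrow> q y = p" if "y \<in> Q" for y
    proof
      assume "v m \<bullet> p = 1 \<and> y = (v m \<bullet> y) *\<^sub>R p"
      then have "q y = (v m \<bullet> y) *\<^sub>R p /\<^sub>R (v m \<bullet> y)" by (simp add: q_def)
      then show "q y = p" using Q[OF that] by simp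
    next
      assume "q y = p"
      then show "v m \<bullet> p = 1 \<and> y = (v m \<bullet> y) *\<^sub>R p" using Q[OF that] by (auto simp: q_def)
    qed
    then show ?thesis by (auto simp: Z_def)
  qed
  have "compact Q"
    unfolding Q_def visible_face_eq
    by (intro compact_Int_closed C closed_Int closed_INT ballI closed_halfspace_ge closed_hyperplane)
  then have "compact (Q \<inter> {y. v m \<bullet> p = 1 \<and> y = (v m \<bullet> y) *\<^sub>R p})"
    by (intro compact_Int_closed closed_Collect_conj closed_Collect_eq continuous_intros)
  then have "compact Z" by (simp add: Z_def Int_def)
  moreover have "Z \<noteq> {}" using True by (auto simp: Z Q_def)
  ultimately obtain y0 where y0: "y0 \<in> Z" and min: "\<And>y. y \<in> Z \<Longrightarrow> v m \<bullet> y0 \<le> v m \<bullet> y"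
    using continuous_attains_inf[of Z "\<lambda>y. v m \<bullet> y"]
      continuous_on_inner[OF continuous_on_const continuous_on_id] by blast
  define N0 where "N0 = {j\<in>N. v j \<bullet> y0 = 1}"
  have y0Q: "y0 \<in> C" "\<And>j. j \<in> N \<Longrightarrow> 1 \<le> v j \<bullet> y0" "0 < v m \<bullet> y0"
    using y0 Q by (auto simp: Z_def Q_def visible_face_def)
  have "N0 \<noteq> {}"
  proof
    assume "N0 = {}"
    then have gt: "1 < v j \<bullet> y0" if "j \<in> N" for j
      using that y0Q(2)[OF that] by (force simp: N0_def)
    \<comment> \<open>The smallest factor by which \<open>y0\<close> can be scaled within the
      constraints in \<open>N\<close>. If none is tight, it is below 1, against the minimality of
      \<open>y0\<close>.\<close>
    define s where "s = Max ((\<lambda>j. 1 / (v j \<bullet> y0)) ` N)"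
    have s: "1 / (v j \<bullet> y0) \<le> s" if "j \<in> N" for j
      using that N by (simp add: s_def)
    have "s < 1"
      unfolding s_def using N gt by (subst Max_less_iff) force+
    have "0 < s" using s[OF N(2)] y0Q(3) by (smt (verit) divide_pos_pos)
    have "s *\<^sub>R y0 \<in> C"
      using convexD[OF C(2) y0Q(1) C(3), of s "1 - s"] \<open>0 < s\<close> \<open>s < 1\<close> by simp
    moreover have "1 \<le> v j \<bullet> (s *\<^sub>R y0)" if "j \<in> N" for j
      using s[OF that] gt[OF that] by (simp add: divide_simps)
    moreover have "q (s *\<^sub>R y0) = q y0"
      using \<open>0 < s\<close> by (simp add: q_def)
    ultimately have "s *\<^sub>R y0 \<in> Z"
      using y0 by (simp add: Z Q_def visible_face_def)
    from min[OF this] show False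
      using \<open>s < 1\<close> y0Q(3) by simp
  qed
  have "p \<in> q ` visible_face C N v G \<longleftrightarrow> G \<subseteq> N0" if "G \<subseteq> N" for G
  proof
    assume "p \<in> q ` visible_face C N v G"
    then obtain y where y: "y \<in> visible_face C N v G" "q y = p" by auto
    then have yZ: "y \<in> Z" by (auto simp: Z Q_def visible_face_def)
    show "G \<subseteq> N0"
    proof
      fix j assume j: "j \<in> G"
      \<comment> \<open>Since \<open>y0\<close> precedes \<open>y\<close> on the ray,
        \<open>v j \<bullet> y = 1\<close> forces \<open>v j \<bullet> y0 \<le> 1\<close>.\<close>
      define s where "s = (v m \<bullet> y0) / (v m \<bullet> y)"
      have "0 < v m \<bullet> y" using yZ Q by (auto simp: Z_def)
      then have "s \<le> 1" using min[OF yZ] by (simp add: s_def)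
      have "y0 = s *\<^sub>R y"
        using yZ y0 y0Q(3) \<open>0 < v m \<bullet> y\<close> unfolding s_def Z_def
        by (smt (verit) mem_Collect_eq nonzero_eq_divide_eq scaleR_scaleR)
      then have "v j \<bullet> y0 \<le> 1"
        using \<open>s \<le> 1\<close> y(1) j by (simp add: visible_face_def)
      then show "j \<in> N0"
        using y0Q(2)[of j] that j by (force simp: N0_def)
    qed
  next
    assume "G \<subseteq> N0"
    then have "y0 \<in> visible_face C N v G"
      using y0Q by (auto simp: visible_face_def N0_def)
    then show "p \<in> q ` visible_face C N v G"
      using y0 by (auto simp: Z)
  qed
  then have "(\<Sum>G\<in>Pow N. (-1) ^ card G * of_bool (p \<in> q ` visible_face C N v G)) =
      (\<Sum>G\<in>Pow N. (-1) ^ card G * of_bool (G \<subseteq> N0) :: real)"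
    by (intro sum.cong) auto
  also have "\<dots> = (\<Sum>G\<in>Pow N0. (-1) ^ card G)"
    using N by (intro sum.mono_neutral_cong_right) (auto simp: N0_def)
  also have "\<dots> = 0"
    using \<open>N0 \<noteq> {}\<close> N by (intro alternating_sum_Pow) (auto simp: N0_def)
  finally show ?thesis .
qed

text \<open>The valuation is applied to the projections, which are empty exactly when the faces are.
  The indicators of the faces themselves need not cancel: where all constraints in \<open>N\<close>
  are strict, only \<open>G = {}\<close> contributes.\<close>

lemma alternating_sum_visible_faces_compact:
  fixes C :: "'a::euclidean_space set" and v :: "'i \<Rightarrow> 'a"
  assumes C: "compact C" "convex C" "0 \<in> C"
    and N: "finite N" "N \<noteq> {}"
  shows "(\<Sum>G\<in>Pow N. (-1) ^ card G * of_bool (visible_face C N v G \<noteq> {})) = (0::real)"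
proof -
  obtain m where m: "m \<in> N" using N by auto
  define q where "q y = y /\<^sub>R (v m \<bullet> y)" for y
  have pos: "0 < v m \<bullet> y" if "y \<in> visible_face C N v G" for y G
    using that m by (force simp: visible_face_def)
  have "compact (visible_face C N v G)" for G
    unfolding visible_face_eq
    by (intro compact_Int_closed C closed_Int closed_INT ballI closed_halfspace_ge closed_hyperplane)
  moreover have "continuous_on (visible_face C N v G) q" for G
    unfolding q_def using pos[of _ G] by (intro continuous_intros) force
  ultimately have "compact (q ` visible_face C N v G)" for G
    by (simp add: compact_continuous_image)
  moreover have "convex (visible_face C N v G)" for G
    unfolding visible_face_eq
    by (intro convex_Int C convex_INT convex_halfspace_ge convex_hyperplane)
  then have "convex (q ` visible_face C N v G)" for G
    unfolding q_def using pos by (intro convex_radial_projection)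
  moreover have "(\<Sum>G\<in>Pow N. (-1) ^ card G * of_bool (p \<in> q ` visible_face C N v G)) = (0::real)" for p
    using alternating_sum_radial_projection[OF C N(1) m] by (simp add: q_def)
  ultimately have "(\<Sum>G\<in>Pow N. (-1) ^ card G * of_bool (q ` visible_face C N v G \<noteq> {})) = (0::real)"
    using N by (intro euler_valuation) auto
  then show ?thesis by simp
qed

text \<open>There are finitely many faces, so a large ball meets every nonempty one; cutting
  \<open>C\<close> with it changes no term. For an empty face \<open>y G\<close> is arbitrary and
  harmless.\<close>

lemma alternating_sum_visible_faces:
  fixes C :: "'a::euclidean_space set" and v :: "'i \<Rightarrow> 'a"
  assumes C: "closed C" "convex C" "0 \<in> C"
    and N: "finite N" "N \<noteq> {}"
  shows "(\<Sum>G\<in>Pow N. (-1) ^ card G * of_bool (visible_face C N v G \<noteq> {})) = (0::real)"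
proof -
  define y where "y G = (SOME y. y \<in> visible_face C N v G)" for G
  obtain R where R: "0 < R" "\<And>G. G \<in> Pow N \<Longrightarrow> norm (y G) \<le> R"
    using finite_imp_bounded[of "y ` Pow N"] N by (auto simp: bounded_pos)
  have "visible_face (C \<inter> cball 0 R) N v G \<noteq> {} \<longleftrightarrow> visible_face C N v G \<noteq> {}" if "G \<in> Pow N" for G
  proof
    assume "visible_face C N v G \<noteq> {}"
    then have "y G \<in> visible_face C N v G" unfolding y_def by (rule some_in_eq[THEN iffD2])
    moreover have "y G \<in> cball 0 R" using R that by auto
    ultimately show "visible_face (C \<inter> cball 0 R) N v G \<noteq> {}"
      by (auto simp: visible_face_def)
  qed (auto simp: visible_face_def)
  then have "(\<Sum>G\<in>Pow N. (-1) ^ card G * of_bool (visible_face C N v G \<noteq> {})) =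
      (\<Sum>G\<in>Pow N. (-1) ^ card G * of_bool (visible_face (C \<inter> cball 0 R) N v G \<noteq> {}) :: real)"
    by (intro sum.cong) auto
  also have "\<dots> = 0"
    using C N R by (intro alternating_sum_visible_faces_compact closed_Int_compact convex_Int) auto
  finally show ?thesis .
qed

section \<open>Polyhedra\<close>

lemma aff_form_eq: "aff_form a b j x = column j a \<bullet> x + b $ j"
  by (simp add: aff_form_def inner_vec_def column_def)

text \<open>Nonemptiness matters for \<open>G = {}\<close>, where the intersection of facets is
  \<open>UNIV\<close> but the right side asks for a point of the polyhedron.\<close>

lemma face_complex_iff:
  assumes "polyhedron_of a b \<noteq> {}"
  shows "G \<in> face_complex a b \<longleftrightarrow>
    (\<exists>y. (\<forall>j. 0 \<le> aff_form a b j y) \<and> (\<forall>j\<in>G. aff_form a b j y = 0))"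
  using assms by (cases "G = {}") (auto simp: face_complex_def facet_def polyhedron_of_def halfspace_def)

lemma alternating_sum_face_complex:
  fixes a :: "real ^ 'n ^ 'd" and b :: "real ^ 'n"
  assumes ne: "polyhedron_of a b \<noteq> {}" and x: "x \<in> flat J a b"
  defines "N \<equiv> {j. aff_form a b j x < 0}"
  assumes "N \<noteq> {}"
  shows "(\<Sum>G\<in>Pow N. (-1) ^ card G * of_bool (J \<union> G \<in> face_complex a b)) = (0::real)"
proof -
  define C where "C = (\<Inter>j\<in>- N. {y. 0 \<le> column j a \<bullet> y + aff_form a b j x}) \<inter>
    (\<Inter>j\<in>J. {y. column j a \<bullet> y = 0})"
  \<comment> \<open>For \<open>j \<in> N\<close> the divisor is positive, so the scaling keeps the
    direction of the inequality.\<close>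
  define v where "v j = column j a /\<^sub>R - aff_form a b j x" for j
  have C': "C = (\<Inter>j\<in>- N. {y. column j a \<bullet> y \<ge> - aff_form a b j x}) \<inter>
    (\<Inter>j\<in>J. {y. column j a \<bullet> y = 0})"
  proof -
    have "0 \<le> s + t \<longleftrightarrow> s \<ge> - t" for s t :: real by linarith
    then show ?thesis by (simp only: C_def)
  qed
  have shift: "aff_form a b j (x + y) = column j a \<bullet> y + aff_form a b j x" for j y
    by (simp add: aff_form_eq inner_add_right)
  have v: "1 \<le> v j \<bullet> y \<longleftrightarrow> 0 \<le> aff_form a b j (x + y)"
    "v j \<bullet> y = 1 \<longleftrightarrow> aff_form a b j (x + y) = 0" if "j \<in> N" for j y
    using that by (auto simp: N_def v_def shift divide_simps)
  have J: "aff_form a b j x = 0" if "j \<in> J" for j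
    using that x by (simp add: flat_def)
  have "visible_face C N v G \<noteq> {} \<longleftrightarrow> J \<union> G \<in> face_complex a b" if G: "G \<subseteq> N" for G
  proof -
    have "y \<in> visible_face C N v G \<longleftrightarrow>
        (\<forall>j. 0 \<le> aff_form a b j (x + y)) \<and> (\<forall>j\<in>J \<union> G. aff_form a b j (x + y) = 0)" for y
    proof -
      have "y \<in> C \<longleftrightarrow> (\<forall>j\<in>- N. 0 \<le> aff_form a b j (x + y)) \<and> (\<forall>j\<in>J. aff_form a b j (x + y) = 0)"
        using J by (simp add: C_def shift)
      then show ?thesis
        using v[of _ y] subsetD[OF G] by (auto simp: visible_face_def)
    qed
    then have "visible_face C N v G \<noteq> {} \<longleftrightarrow>
        (\<exists>y. (\<forall>j. 0 \<le> aff_form a b j (x + y)) \<and> (\<forall>j\<in>J \<union> G. aff_form a b j (x + y) = 0))"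
      by blast
    also have "\<dots> \<longleftrightarrow> J \<union> G \<in> face_complex a b"
      unfolding face_complex_iff[OF ne] by (metis add_diff_cancel_left' diff_add_cancel add.commute)
    finally show ?thesis .
  qed
  then have "(\<Sum>G\<in>Pow N. (-1) ^ card G * of_bool (J \<union> G \<in> face_complex a b)) =
      (\<Sum>G\<in>Pow N. (-1) ^ card G * of_bool (visible_face C N v G \<noteq> {}) :: real)"
    by (intro sum.cong) auto
  also have "\<dots> = 0"
  proof (rule alternating_sum_visible_faces)
    show "closed C" unfolding C'
      by (intro closed_Int closed_INT ballI closed_halfspace_ge closed_hyperplane)
    show "convex C" unfolding C'
      by (intro convex_Int convex_INT convex_halfspace_ge convex_hyperplane)
    show "0 \<in> C" by (auto simp: C_def N_def)
  qed (use \<open>N \<noteq> {}\<close> in auto)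
  finally show ?thesis .
qed

theorem proposition1:
  fixes a :: "real ^ 'n ^ 'd" and b :: "real ^ 'n" and J :: "'n set" and x :: "real ^ 'd"
  assumes "bounding_halfspaces a b"
    and "general_position a b"
    and "J \<in> face_complex a b"
    and "x \<in> flat J a b"
  shows "(\<Prod>j\<in>UNIV - J. heaviside ((\<Sum>i\<in>UNIV. a $ i $ j * x $ i) + b $ j)) =
    (\<Sum>F\<in>face_complex_above a b J.
       \<Prod>j\<in>F - J. (heaviside ((\<Sum>i\<in>UNIV. a $ i $ j * x $ i) + b $ j) - 1))"
proof -
  define N where "N = {j. aff_form a b j x < 0}"
  have H: "heaviside ((\<Sum>i\<in>UNIV. a $ i $ j * x $ i) + b $ j) = of_bool (j \<notin> N)" for j
    by (auto simp: N_def heaviside_def aff_form_def)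
  have ne: "polyhedron_of a b \<noteq> {}"
    using assms(1) interior_empty by (auto simp: bounding_halfspaces_def)
  have NJ: "N \<inter> J = {}"
    using assms(4) by (auto simp: N_def flat_def)
  \<comment> \<open>An index outside \<open>N\<close> contributes a factor \<open>1 - 1\<close>, an
    index in \<open>N\<close> a factor \<open>-1\<close>.\<close>
  have term_eq: "(\<Prod>j\<in>F - J. of_bool (j \<notin> N) - 1 :: real) = (-1) ^ card (F - J) * of_bool (F - J \<subseteq> N)"
    for F
  proof (cases "F - J \<subseteq> N")
    case True
    then have "(\<Prod>j\<in>F - J. of_bool (j \<notin> N) - 1 :: real) = (\<Prod>j\<in>F - J. -1)"
      by (intro prod.cong) auto
    with True show ?thesis by simp
  qed (auto intro!: prod_zero)
  have "(\<Sum>F\<in>face_complex_above a b J. \<Prod>j\<in>F - J. of_bool (j \<notin> N) - 1) =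
      (\<Sum>F\<in>{F\<in>face_complex_above a b J. F - J \<subseteq> N}. (-1) ^ card (F - J) :: real)"
    unfolding term_eq by (intro sum.mono_neutral_cong_right) auto
  \<comment> \<open>As \<open>N\<close> misses \<open>J\<close>, the sets \<open>F\<close> that
    survive are exactly the \<open>J \<union> G\<close> with \<open>G \<subseteq> N\<close>.\<close>
  also have "\<dots> = (\<Sum>G\<in>{G\<in>Pow N. J \<union> G \<in> face_complex a b}. (-1) ^ card G)"
    using NJ
    by (intro sum.reindex_bij_witness[of _ "\<lambda>G. J \<union> G" "\<lambda>F. F - J"])
      (auto simp: face_complex_above_def Un_absorb1)
  also have "\<dots> = (\<Sum>G\<in>Pow N. (-1) ^ card G * of_bool (J \<union> G \<in> face_complex a b))"
    by (intro sum.mono_neutral_cong_left) auto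
  also have "\<dots> = of_bool (N = {})"
  proof (cases "N = {}")
    case True
    then show ?thesis using assms(3) by simp
  next
    case False
    then show ?thesis
      using alternating_sum_face_complex[OF ne assms(4)] by (simp add: N_def)
  qed
  also have "\<dots> = (\<Prod>j\<in>UNIV - J. of_bool (j \<notin> N))"
    using NJ by (cases "N = {}") (auto intro!: prod_zero[symmetric])
  finally show ?thesis by (simp add: H)
qed

end
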